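(* Let $f:\mathbb{R}\to\mathbb{R}$ be a nonconstant tropical meromorphic function, let $q\ge1$, and let $a_1,\dots,a_q\in\mathbb{R}\cup\{-\infty\}$ be distinct. Then $$(q-2)T(r,f)+N(r,f)+N(r,1_{\mathbb{T}}\oslash f)\le\sum_{j=1}^q\Bigl(N\bigl(r,1_{\mathbb{T}}\oslash(f\oplus a_j)\bigr)+N(r,f)-N(r,f\oplus a_j)\Bigr)+O(1).$$ In addition, if $$\max\{a_1,\dots,a_q\}<\inf\{f(\alpha):\omega_f(\alpha)<0\},$$ then $$(q-2)T(r,f)+N(r,f)+N(r,1_{\mathbb{T}}\oslash f)\le\sum_{j=1}^q N\bigl(r,1_{\mathbb{T}}\oslash(f\oplus a_j)\bigr)+O(1).$$ Both inequalities hold for all $r>0$, with $O(1)$ denoting a quantity bounded independently of $r$.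
   Context: Tropical notation: $x\oplus y=\max(x,y)$, $x\otimes y=x+y$, $x\oslash y=x-y$ on $\mathbb{T}=\mathbb{R}\cup\{-\infty\}$, $0_{\mathbb{T}}=-\infty$, $1_{\mathbb{T}}=0$; so $f\oplus a$ is the function $x\mapsto\max(f(x),a)$ (equal to $f$ if $a=-\infty$), and $1_{\mathbb{T}}\oslash g=-g$. A tropical meromorphic function is a continuous piecewise linear $g:\mathbb{R}\to\mathbb{R}$ (real slopes, finitely many non-differentiability points in each bounded interval). Put $\omega_g(x)=\lim_{\varepsilon\to0^+}(g'(x+\varepsilon)-g'(x-\varepsilon))$; $x$ is a pole of $g$ with multiplicity $-\omega_g(x)$ if $\omega_g(x)<0$, and a root with multiplicity $\omega_g(x)$ if $\omega_g(x)>0$. With $g^+=\max(g,0)$: the proximity function is $m(r,g)=\frac12(g^+(r)+g^+(-r))$; the counting function is $N(r,g)=\frac12\int_0^r n(t,g)\,dt$ with $n(t,g)=\sum_{|s|\le t,\ \omega_g(s)<0}|\omega_g(s)|$; the characteristic is $T(r,g)=m(r,g)+N(r,g)$. The infimum of the empty set is $+\infty$. *)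

theory Defs
  imports "HOL-Analysis.Analysis"
begin

definition nondiff_points :: "(real \<Rightarrow> real) \<Rightarrow> real set" where
  "nondiff_points g = {x. \<not> g differentiable (at x)}"

definition tropical_meromorphic :: "(real \<Rightarrow> real) \<Rightarrow> bool" where
  "tropical_meromorphic g \<longleftrightarrow>
     continuous_on UNIV g \<and>
     (\<forall>a b. finite (nondiff_points g \<inter> {a..b})) \<and>
     (\<forall>a b. {a<..<b} \<inter> nondiff_points g = {} \<longrightarrow>
        (\<exists>m c. \<forall>x\<in>{a<..<b}. g x = m * x + c))"

definition trop_omega :: "(real \<Rightarrow> real) \<Rightarrow> real \<Rightarrow> real" where
  "trop_omega g x = Lim (at_right 0) (\<lambda>\<epsilon>. deriv g (x + \<epsilon>) - deriv g (x - \<epsilon>))"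

definition trop_poles :: "(real \<Rightarrow> real) \<Rightarrow> real set" where
  "trop_poles g = {x. trop_omega g x < 0}"

definition trop_proximity :: "real \<Rightarrow> (real \<Rightarrow> real) \<Rightarrow> real" where
  "trop_proximity r g = (max (g r) 0 + max (g (- r)) 0) / 2"

definition trop_pole_count :: "real \<Rightarrow> (real \<Rightarrow> real) \<Rightarrow> real" where
  "trop_pole_count t g = (\<Sum>s\<in>{s \<in> trop_poles g. \<bar>s\<bar> \<le> t}. \<bar>trop_omega g s\<bar>)"

definition trop_counting :: "real \<Rightarrow> (real \<Rightarrow> real) \<Rightarrow> real" where
  "trop_counting r g = (1 / 2) * integral {0..r} (\<lambda>t. trop_pole_count t g)"

definition trop_characteristic :: "real \<Rightarrow> (real \<Rightarrow> real) \<Rightarrow> real" where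
  "trop_characteristic r g = trop_proximity r g + trop_counting r g"

text \<open>Elements of the max-plus semiring, the reals with \<open>-\<infinity>\<close> adjoined, are the extended
  reals other than \<open>\<infinity>\<close>; the value of the following at \<open>a = \<infinity>\<close> is meaningless.\<close>

definition trop_add :: "(real \<Rightarrow> real) \<Rightarrow> ereal \<Rightarrow> real \<Rightarrow> real" where
  "trop_add g a = (\<lambda>x. real_of_ereal (max (ereal (g x)) a))"

text \<open>The tropical reciprocal: the tropical unit is \<open>0\<close> and tropical division is subtraction.\<close>

definition trop_recip :: "(real \<Rightarrow> real) \<Rightarrow> real \<Rightarrow> real" where
  "trop_recip g = (\<lambda>x. 0 - g x)"

end

theory Submission
  imports Defs
begin

text \<open>
  Both inequalities come from the tropical Jensen formula
  \<open>N(r, 1 \<oslash> g) - N(r, g) = (g(r) + g(-r)) / 2 - g(0)\<close>,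
  lemma \<open>tropical_jensen\<close>. For its proof, the difference of the two counting integrands at \<open>t\<close> is
  the sum of all slope jumps of \<open>g\<close> in \<open>[-t, t]\<close>. This sum telescopes to the right slope at \<open>t\<close>
  minus the left slope at \<open>-t\<close> (\<open>sum_slope_jumps\<close>), which is the derivative of \<open>g(t) + g(-t)\<close>.

  Apply the formula to \<open>f \<oplus> a\<close>. For real \<open>a\<close>, the function \<open>f \<oplus> a = max(f, a)\<close> is within \<open>\<bar>a\<bar>\<close> of
  \<open>max(f, 0)\<close>, so the boundary term is the proximity function of \<open>f\<close> up to a bounded error, and the
  summand of index \<open>j\<close> is \<open>T(r, f) + O(1)\<close>. For \<open>a = -\<infinity>\<close> the summand is exactly \<open>N(r, 1 \<oslash> f)\<close>,
  and as the \<open>a\<^sub>j\<close> are distinct this happens at most once. The right-hand side is therefore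
  \<open>q T(r, f)\<close> or \<open>(q - 1) T(r, f) + N(r, 1 \<oslash> f)\<close>, up to a bounded error. It remains to use
  \<open>N(r, f) \<le> T(r, f)\<close> in the second case, and also \<open>N(r, 1 \<oslash> f) \<le> T(r, f) + O(1)\<close>, again by
  Jensen, in the first.

  If every \<open>a\<^sub>j\<close> lies below all values of \<open>f\<close> at its poles, then \<open>f \<oplus> a\<^sub>j\<close> agrees with \<open>f\<close> near
  each pole of \<open>f\<close>. It thus inherits these poles with their multiplicities, so
  \<open>N(r, f) - N(r, f \<oplus> a\<^sub>j) \<le> 0\<close> and the second inequality follows from the first.
\<close>

section \<open>One-sided slopes\<close>

text \<open>
  The counting functions depend on \<open>g\<close> only through its left and right slopes at each point. Unlike
  a description by global breakpoints, this local one passes to \<open>max(g, a)\<close> by a case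
  distinction at a single point.
\<close>

definition has_slopes :: "(real \<Rightarrow> real) \<Rightarrow> real \<Rightarrow> real \<Rightarrow> real \<Rightarrow> bool" where
  "has_slopes g x l r \<longleftrightarrow>
     (\<exists>e>0. \<forall>h. 0 \<le> h \<and> h < e \<longrightarrow> g (x + h) = g x + r * h \<and> g (x - h) = g x - l * h)"

lemma has_slopesE:
  assumes "has_slopes g x l r"
  obtains e where "e > 0"
    and "\<And>h. 0 \<le> h \<Longrightarrow> h < e \<Longrightarrow> g (x + h) = g x + r * h"
    and "\<And>h. 0 \<le> h \<Longrightarrow> h < e \<Longrightarrow> g (x - h) = g x - l * h"
  using assms unfolding has_slopes_def by blast

lemma has_slopesI:
  assumes "e > 0"
    and "\<And>h. 0 \<le> h \<Longrightarrow> h < e \<Longrightarrow> g (x + h) = g x + r * h"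
    and "\<And>h. 0 \<le> h \<Longrightarrow> h < e \<Longrightarrow> g (x - h) = g x - l * h"
  shows "has_slopes g x l r"
  using assms unfolding has_slopes_def by blast

lemma has_slopes_unique:
  assumes "has_slopes g x l r" "has_slopes g x l' r'"
  shows "l = l'" "r = r'"
proof -
  obtain e where e: "e > 0" "\<And>h. 0 \<le> h \<Longrightarrow> h < e \<Longrightarrow> g (x + h) = g x + r * h"
      "\<And>h. 0 \<le> h \<Longrightarrow> h < e \<Longrightarrow> g (x - h) = g x - l * h"
    using assms(1) by (rule has_slopesE) blast
  obtain e' where e': "e' > 0" "\<And>h. 0 \<le> h \<Longrightarrow> h < e' \<Longrightarrow> g (x + h) = g x + r' * h"
      "\<And>h. 0 \<le> h \<Longrightarrow> h < e' \<Longrightarrow> g (x - h) = g x - l' * h"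
    using assms(2) by (rule has_slopesE) blast
  define h where "h = min e e' / 2"
  have h: "0 < h" "h < e" "h < e'" using e(1) e'(1) by (auto simp: h_def)
  show "l = l'" using e(3)[of h] e'(3)[of h] h by simp
  show "r = r'" using e(2)[of h] e'(2)[of h] h by simp
qed

lemma has_slopes_nearby:
  assumes "has_slopes g x l r"
  obtains e where "e > 0"
    and "\<And>y. x < y \<Longrightarrow> y < x + e \<Longrightarrow> has_slopes g y r r"
    and "\<And>y. x - e < y \<Longrightarrow> y < x \<Longrightarrow> has_slopes g y l l"
proof -
  obtain e where e: "e > 0" "\<And>h. 0 \<le> h \<Longrightarrow> h < e \<Longrightarrow> g (x + h) = g x + r * h"
      "\<And>h. 0 \<le> h \<Longrightarrow> h < e \<Longrightarrow> g (x - h) = g x - l * h"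
    using assms by (rule has_slopesE) blast
  have right: "g y = g x + r * (y - x)" if "x \<le> y" "y < x + e" for y
    using e(2)[of "y - x"] that by simp
  have left: "g y = g x + l * (y - x)" if "x - e < y" "y \<le> x" for y
    using e(3)[of "x - y"] that by (simp add: algebra_simps)
  show thesis
  proof (rule that[OF e(1)])
    fix y assume y: "x < y" "y < x + e"
    show "has_slopes g y r r"
    proof (rule has_slopesI[of "min (y - x) (x + e - y)"])
      fix h assume "0 \<le> h" "h < min (y - x) (x + e - y)"
      then show "g (y + h) = g y + r * h" "g (y - h) = g y - r * h"
        using y right[of y] right[of "y + h"] right[of "y - h"] by (auto simp: algebra_simps)
    qed (use y in simp)
  next
    fix y assume y: "x - e < y" "y < x"
    show "has_slopes g y l l"
    proof (rule has_slopesI[of "min (x - y) (y - (x - e))"])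
      fix h assume "0 \<le> h" "h < min (x - y) (y - (x - e))"
      then show "g (y + h) = g y + l * h" "g (y - h) = g y - l * h"
        using y left[of y] left[of "y + h"] left[of "y - h"] by (auto simp: algebra_simps)
    qed (use y in simp)
  qed
qed

lemma has_slopes_imp_DERIV:
  assumes "has_slopes g x m m"
  shows "(g has_real_derivative m) (at x)"
proof -
  obtain e where e: "e > 0" "\<And>h. 0 \<le> h \<Longrightarrow> h < e \<Longrightarrow> g (x + h) = g x + m * h"
      "\<And>h. 0 \<le> h \<Longrightarrow> h < e \<Longrightarrow> g (x - h) = g x - m * h"
    using assms by (rule has_slopesE) blast
  have lin: "g x + m * (y - x) = g y" if "y \<in> ball x e" for y
  proof (cases "x \<le> y")
    case True
    then show ?thesis using e(2)[of "y - x"] that by (simp add: dist_real_def)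
  next
    case False
    then show ?thesis using e(3)[of "x - y"] that by (simp add: dist_real_def algebra_simps)
  qed
  have "((\<lambda>y. g x + m * (y - x)) has_real_derivative m) (at x)"
    by (auto intro!: derivative_eq_intros)
  then show ?thesis
    by (rule has_field_derivative_transform_within_open[where S = "ball x e"])
       (use e(1) lin in auto)
qed

lemma trop_omega_eq:
  assumes "has_slopes g x l r"
  shows "trop_omega g x = r - l"
proof -
  obtain e where e: "e > 0" "\<And>y. x < y \<Longrightarrow> y < x + e \<Longrightarrow> has_slopes g y r r"
      "\<And>y. x - e < y \<Longrightarrow> y < x \<Longrightarrow> has_slopes g y l l"
    using assms by (rule has_slopes_nearby) blast
  have "deriv g (x + h) - deriv g (x - h) = r - l" if "0 < h" "h < e" for h
    using e(2)[of "x + h"] e(3)[of "x - h"] that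
    by (auto dest!: has_slopes_imp_DERIV DERIV_imp_deriv)
  then have "eventually (\<lambda>h. deriv g (x + h) - deriv g (x - h) = r - l) (at_right 0)"
    using e(1) by (auto simp: eventually_at_right_field)
  then have "((\<lambda>h. deriv g (x + h) - deriv g (x - h)) \<longlongrightarrow> r - l) (at_right 0)"
    by (rule tendsto_eventually)
  then show ?thesis
    unfolding trop_omega_def by (intro tendsto_Lim) auto
qed

text \<open>The reflection \<open>g \<mapsto> 1 \<oslash> g\<close> turns roots into poles, so only pole counts are ever needed.\<close>

lemma has_slopes_trop_recip:
  assumes "has_slopes g x l r"
  shows "has_slopes (trop_recip g) x (- l) (- r)"
  using assms unfolding has_slopes_def trop_recip_def by (auto simp: algebra_simps)

lemma trop_add_ereal [simp]: "trop_add g (ereal c) = (\<lambda>x. max (g x) c)"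
  by (auto simp: trop_add_def fun_eq_iff max_def)

lemma trop_add_MInf [simp]: "trop_add g (-\<infinity>) = g"
  by (simp add: trop_add_def fun_eq_iff)

lemma has_slopes_continuous:
  assumes "has_slopes g x l r"
  shows "isCont g x"
proof -
  obtain e where e: "e > 0" "\<And>h. 0 \<le> h \<Longrightarrow> h < e \<Longrightarrow> g (x + h) = g x + r * h"
      "\<And>h. 0 \<le> h \<Longrightarrow> h < e \<Longrightarrow> g (x - h) = g x - l * h"
    using assms by (rule has_slopesE) blast
  have pl: "g x + (r * max (y - x) 0 + l * min (y - x) 0) = g y" if "y \<in> ball x e" for y
  proof (cases "x \<le> y")
    case True
    then show ?thesis using e(2)[of "y - x"] that by (simp add: dist_real_def)
  next
    case False
    then show ?thesis using e(3)[of "x - y"] that by (simp add: dist_real_def algebra_simps)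
  qed
  have "continuous_on (ball x e) (\<lambda>y. g x + (r * max (y - x) 0 + l * min (y - x) 0))"
    by (intro continuous_intros)
  then have "continuous_on (ball x e) g"
    using pl by (rule continuous_on_eq)
  then show ?thesis
    using e(1) by (simp add: continuous_on_eq_continuous_at)
qed

lemma has_slopes_cong:
  assumes "has_slopes g x l r" and "d > 0"
    and "\<And>y. \<bar>y - x\<bar> < d \<Longrightarrow> k y = g y"
  shows "has_slopes k x l r"
proof -
  obtain e where e: "e > 0" "\<And>h. 0 \<le> h \<Longrightarrow> h < e \<Longrightarrow> g (x + h) = g x + r * h"
      "\<And>h. 0 \<le> h \<Longrightarrow> h < e \<Longrightarrow> g (x - h) = g x - l * h"
    using assms(1) by (rule has_slopesE) blast
  show ?thesis
    by (rule has_slopesI[of "min d e"]) (use e assms(2,3) in auto)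
qed

lemma has_slopes_trop_add_above:
  assumes g: "has_slopes g x l r" and a: "a < ereal (g x)"
  shows "has_slopes (trop_add g a) x l r"
proof (cases a)
  case (real c)
  have "eventually (\<lambda>y. c < g y) (nhds x)"
    using has_slopes_continuous[OF g] a real
    by (auto simp: isCont_def tendsto_at_iff_tendsto_nhds intro: order_tendstoD)
  then obtain d where d: "d > 0" "\<And>y. dist y x < d \<Longrightarrow> c < g y"
    by (auto simp: eventually_nhds_metric)
  show ?thesis
    by (rule has_slopes_cong[OF g d(1)]) (use d(2) real in \<open>force simp: dist_real_def\<close>)
qed (use assms in auto)

lemma has_slopes_trop_add:
  assumes g: "has_slopes g x l r" and a: "a \<noteq> \<infinity>"
  shows "\<exists>l' r'. has_slopes (trop_add g a) x l' r'"
proof (cases a)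
  case (real c)
  consider "c < g x" | "g x < c" | "g x = c" by linarith
  then show ?thesis
  proof cases
    case 1
    then show ?thesis using has_slopes_trop_add_above[OF g, of a] real by auto
  next
    case 2
    have "eventually (\<lambda>y. g y < c) (nhds x)"
      using has_slopes_continuous[OF g] 2
      by (auto simp: isCont_def tendsto_at_iff_tendsto_nhds intro: order_tendstoD)
    then obtain d where d: "d > 0" "\<And>y. dist y x < d \<Longrightarrow> g y < c"
      by (auto simp: eventually_nhds_metric)
    have "has_slopes (\<lambda>y. c) x 0 0" by (rule has_slopesI[of 1]) auto
    then have "has_slopes (trop_add g a) x 0 0"
      by (rule has_slopes_cong[OF _ d(1)]) (use d(2) real in \<open>force simp: dist_real_def\<close>)
    then show ?thesis by blast
  next
    case 3
    obtain e where e: "e > 0" "\<And>h. 0 \<le> h \<Longrightarrow> h < e \<Longrightarrow> g (x + h) = g x + r * h"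
        "\<And>h. 0 \<le> h \<Longrightarrow> h < e \<Longrightarrow> g (x - h) = g x - l * h"
      using g by (rule has_slopesE) blast
    (* At a point where g = c the maximum keeps only upward branches: going right it
       follows g when r > 0, going left when l < 0, and is flat otherwise. *)
    have "has_slopes (trop_add g a) x (min l 0) (max r 0)"
    proof (rule has_slopesI[OF e(1)])
      fix h :: real assume h: "0 \<le> h" "h < e"
      show "trop_add g a (x + h) = trop_add g a x + max r 0 * h"
        using e(2)[OF h] h(1) 3 real by (auto simp: max_def mult_le_0_iff zero_le_mult_iff)
      show "trop_add g a (x - h) = trop_add g a x - min l 0 * h"
        using e(3)[OF h] h(1) 3 real
        by (auto simp: max_def min_def mult_le_0_iff zero_le_mult_iff)
    qed
    then show ?thesis by blast
  qed
qed (use assms in auto)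

text \<open>
  Breakpoints are locally finite, so both sides of \<open>x\<close> begin with an open interval of
  affinity. Continuity identifies the affine value at \<open>x\<close> with \<open>g x\<close>.
\<close>

lemma tropical_meromorphic_has_slopes:
  assumes "tropical_meromorphic g"
  obtains L R where "\<And>x. has_slopes g x (L x) (R x)"
proof -
  have cont: "continuous_on UNIV g"
    and fin: "\<And>a b. finite (nondiff_points g \<inter> {a..b})"
    and lin: "\<And>a b. {a<..<b} \<inter> nondiff_points g = {} \<Longrightarrow> \<exists>m c. \<forall>x\<in>{a<..<b}. g x = m * x + c"
    using assms unfolding tropical_meromorphic_def by blast+
  have "\<exists>l r. has_slopes g x l r" for x
  proof -
    obtain d where d: "d > 0"
      "\<And>y. y \<in> nondiff_points g \<inter> {x - 1..x + 1} \<Longrightarrow> y \<noteq> x \<Longrightarrow> d \<le> dist x y"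
      using finite_set_avoid[OF fin[of "x - 1" "x + 1"], of x] by blast
    define e where "e = min d 1"
    have e: "e > 0" using d(1) by (simp add: e_def)
    have free: "y \<notin> nondiff_points g" if "y \<noteq> x" "\<bar>y - x\<bar> < e" for y
    proof
      assume "y \<in> nondiff_points g"
      then have "d \<le> dist x y" using that by (intro d(2)) (auto simp: e_def)
      then show False using that by (simp add: e_def dist_real_def abs_minus_commute)
    qed
    have "{x<..<x + e} \<inter> nondiff_points g = {}" "{x - e<..<x} \<inter> nondiff_points g = {}"
      using free by auto
    then obtain m c m' c' where right: "\<And>y. y \<in> {x<..<x + e} \<Longrightarrow> g y = m * y + c"
      and left: "\<And>y. y \<in> {x - e<..<x} \<Longrightarrow> g y = m' * y + c'"
      using lin by meson
    have lim: "(g \<longlongrightarrow> g x) (at x)"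
      using cont by (simp add: continuous_on_eq_continuous_at isCont_def)
    have "(g \<longlongrightarrow> g x) (at_right x)"
      using lim by (rule tendsto_within_subset) auto
    moreover have "eventually (\<lambda>y. g y = m * y + c) (at_right x)"
      using e right by (auto simp: eventually_at_right_field intro!: exI[of _ "x + e"])
    ultimately have "((\<lambda>y. m * y + c) \<longlongrightarrow> g x) (at_right x)"
      by (rule Lim_transform_eventually)
    moreover have "((\<lambda>y. m * y + c) \<longlongrightarrow> m * x + c) (at_right x)"
      by (intro tendsto_intros)
    ultimately have r: "g x = m * x + c"
      using tendsto_unique[of "at_right x"] by force
    have "(g \<longlongrightarrow> g x) (at_left x)"
      using lim by (rule tendsto_within_subset) auto
    moreover have "eventually (\<lambda>y. g y = m' * y + c') (at_left x)"
      using e left by (auto simp: eventually_at_left_field intro!: exI[of _ "x - e"])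
    ultimately have "((\<lambda>y. m' * y + c') \<longlongrightarrow> g x) (at_left x)"
      by (rule Lim_transform_eventually)
    moreover have "((\<lambda>y. m' * y + c') \<longlongrightarrow> m' * x + c') (at_left x)"
      by (intro tendsto_intros)
    ultimately have l: "g x = m' * x + c'"
      using tendsto_unique[of "at_left x"] by force
    have "has_slopes g x m' m"
    proof (rule has_slopesI[OF e])
      fix h :: real assume "0 \<le> h" "h < e"
      then show "g (x + h) = g x + m * h" "g (x - h) = g x - m' * h"
        using right[of "x + h"] left[of "x - h"] l r
        by (cases "h = 0"; simp add: algebra_simps)+
    qed
    then show ?thesis by blast
  qed
  then show thesis using that by metis
qed

section \<open>Jensen's formula\<close>

text \<open>
  Bisection reduces the telescoping of the jumps over \<open>(a, b]\<close> to short intervals containing a given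
  point, where at most that point is a breakpoint. With half-open intervals and right slopes
  no jump is counted twice at a common end point.
\<close>

lemma sum_slope_jumps_half_open:
  assumes g: "\<And>x. has_slopes g x (L x) (R x)" and "a \<le> b"
  shows "finite {s \<in> {a<..b}. L s \<noteq> R s} \<and> (\<Sum>s | s \<in> {a<..b} \<and> L s \<noteq> R s. R s - L s) = R b - R a"
  using \<open>a \<le> b\<close>
proof (rule Bolzano[where P = "\<lambda>a b. finite {s \<in> {a<..b}. L s \<noteq> R s} \<and>
      (\<Sum>s | s \<in> {a<..b} \<and> L s \<noteq> R s. R s - L s) = R b - R a"])
  fix a b c :: real
  assume ab: "finite {s \<in> {a<..b}. L s \<noteq> R s} \<and>
      (\<Sum>s | s \<in> {a<..b} \<and> L s \<noteq> R s. R s - L s) = R b - R a"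
    and bc: "finite {s \<in> {b<..c}. L s \<noteq> R s} \<and>
      (\<Sum>s | s \<in> {b<..c} \<and> L s \<noteq> R s. R s - L s) = R c - R b"
    and le: "a \<le> b" "b \<le> c"
  have eq: "{s. s \<in> {a<..c} \<and> L s \<noteq> R s} =
      {s. s \<in> {a<..b} \<and> L s \<noteq> R s} \<union> {s. s \<in> {b<..c} \<and> L s \<noteq> R s}"
    using le by auto
  show "finite {s \<in> {a<..c}. L s \<noteq> R s} \<and>
      (\<Sum>s | s \<in> {a<..c} \<and> L s \<noteq> R s. R s - L s) = R c - R a"
    unfolding eq using ab bc by (subst sum.union_disjoint) auto
next
  fix x :: real
  obtain e where e: "e > 0" "\<And>y. x < y \<Longrightarrow> y < x + e \<Longrightarrow> has_slopes g y (R x) (R x)"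
      "\<And>y. x - e < y \<Longrightarrow> y < x \<Longrightarrow> has_slopes g y (L x) (L x)"
    using has_slopes_nearby[OF g[of x]] by metis
  have right: "L y = R x \<and> R y = R x" if "x < y" "y < x + e" for y
    using has_slopes_unique[OF g e(2)] that by blast
  have left: "L y = L x \<and> R y = L x" if "x - e < y" "y < x" for y
    using has_slopes_unique[OF g e(3)] that by blast
  have "finite {s \<in> {a<..b}. L s \<noteq> R s} \<and>
      (\<Sum>s | s \<in> {a<..b} \<and> L s \<noteq> R s. R s - L s) = R b - R a"
    if ab: "a \<le> x" "x \<le> b" "b - a < e" for a b
  proof -
    have eq: "{s. s \<in> {a<..b} \<and> L s \<noteq> R s} = (if a < x \<and> L x \<noteq> R x then {x} else {})"
    proof (intro set_eqI iffI)
      fix s assume s: "s \<in> {s. s \<in> {a<..b} \<and> L s \<noteq> R s}"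
      then have "s = x"
        using left[of s] right[of s] ab by (cases s x rule: linorder_cases) auto
      then show "s \<in> (if a < x \<and> L x \<noteq> R x then {x} else {})" using s by auto
    qed (use ab in \<open>auto split: if_splits\<close>)
    have "R b = R x" using right[of b] ab by (cases "b = x") auto
    moreover have "a < x \<Longrightarrow> R a = L x" using left[of a] ab by auto
    ultimately show ?thesis
      unfolding eq using ab(1) by (cases "a = x") auto
  qed
  then show "\<exists>d>0. \<forall>a b. a \<le> x \<and> x \<le> b \<and> b - a < d \<longrightarrow>
      finite {s \<in> {a<..b}. L s \<noteq> R s} \<and>
      (\<Sum>s | s \<in> {a<..b} \<and> L s \<noteq> R s. R s - L s) = R b - R a"
    using e(1) by (intro exI[of _ e]) simp
qed

lemma sum_slope_jumps:
  assumes g: "\<And>x. has_slopes g x (L x) (R x)" and "a \<le> b"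
  shows "finite {s \<in> {a..b}. L s \<noteq> R s}"
    and "(\<Sum>s | s \<in> {a..b} \<and> L s \<noteq> R s. R s - L s) = R b - L a"
proof -
  let ?A = "{s. s \<in> {a<..b} \<and> L s \<noteq> R s}"
  have eq: "{s. s \<in> {a..b} \<and> L s \<noteq> R s} = (if L a \<noteq> R a then insert a ?A else ?A)"
    using \<open>a \<le> b\<close> by (auto simp: order_le_less)
  have A: "finite ?A" "(\<Sum>s\<in>?A. R s - L s) = R b - R a"
    using sum_slope_jumps_half_open[OF g \<open>a \<le> b\<close>] by auto
  show "finite {s \<in> {a..b}. L s \<noteq> R s}" using A(1) eq by auto
  show "(\<Sum>s | s \<in> {a..b} \<and> L s \<noteq> R s. R s - L s) = R b - L a"
  proof (cases "L a = R a")
    case True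
    then show ?thesis using A(2) by (simp only: eq) simp
  next
    case False
    have "sum (\<lambda>s. R s - L s) (insert a ?A) = (R a - L a) + sum (\<lambda>s. R s - L s) ?A"
      using A(1) by (rule sum.insert) simp
    then show ?thesis using A(2) False by (simp only: eq) simp
  qed
qed

lemma finite_trop_poles:
  assumes g: "\<And>x. has_slopes g x (L x) (R x)"
  shows "finite {s \<in> trop_poles g. \<bar>s\<bar> \<le> t}"
proof (cases "t \<ge> 0")
  case True
  have "{s \<in> trop_poles g. \<bar>s\<bar> \<le> t} \<subseteq> {s \<in> {-t..t}. L s \<noteq> R s}"
    using trop_omega_eq[OF g] by (auto simp: trop_poles_def)
  then show ?thesis
    by (rule finite_subset) (rule sum_slope_jumps(1)[OF g], use True in simp)
next
  case False
  then have "{s \<in> trop_poles g. \<bar>s\<bar> \<le> t} = {}" by auto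
  then show ?thesis by (metis finite.emptyI)
qed

lemma trop_pole_count_integrable:
  assumes g: "\<And>x. has_slopes g x (L x) (R x)"
  shows "(\<lambda>t. trop_pole_count t g) integrable_on {a..b}"
proof (rule integrable_on_mono_on)
  show "mono_on {a..b} (\<lambda>t. trop_pole_count t g)"
    unfolding trop_pole_count_def
    by (intro mono_onI sum_mono2 finite_trop_poles[OF g]) auto
qed

text \<open>
  A jump of the slope counts positively as a root, that is a pole of \<open>1 \<oslash> g\<close>, or negatively as
  a pole of \<open>g\<close>, so the difference of the two counts is the signed sum of all jumps.
\<close>

lemma trop_pole_count_recip_diff:
  assumes g: "\<And>x. has_slopes g x (L x) (R x)" and "t \<ge> 0"
  shows "trop_pole_count t (trop_recip g) - trop_pole_count t g = R t - L (- t)"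
proof -
  have om: "trop_omega g s = R s - L s" "trop_omega (trop_recip g) s = L s - R s" for s
    using trop_omega_eq[OF g] trop_omega_eq[OF has_slopes_trop_recip[OF g]] by auto
  let ?S = "{s. s \<in> {-t..t} \<and> L s \<noteq> R s}"
  have fin: "finite ?S"
    and total: "(\<Sum>s\<in>?S. R s - L s) = R t - L (- t)"
    using sum_slope_jumps[OF g, of "- t" t] \<open>t \<ge> 0\<close> by auto
  have roots: "trop_pole_count t (trop_recip g) = (\<Sum>s\<in>?S. max (R s - L s) 0)"
    unfolding trop_pole_count_def
    by (rule sum.mono_neutral_cong_left[OF fin]) (auto simp: trop_poles_def om)
  have poles: "trop_pole_count t g = (\<Sum>s\<in>?S. max (L s - R s) 0)"
    unfolding trop_pole_count_def
    by (rule sum.mono_neutral_cong_left[OF fin]) (auto simp: trop_poles_def om)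
  have "(\<Sum>s\<in>?S. max (R s - L s) 0 - max (L s - R s) 0) = (\<Sum>s\<in>?S. R s - L s)"
    by (rule sum.cong) auto
  then show ?thesis
    using roots poles total by (simp only: sum_subtractf)
qed

text \<open>
  The counting integrand difference is the derivative of \<open>g(t) + g(-t)\<close> wherever neither \<open>t\<close>
  nor \<open>-t\<close> is a breakpoint of \<open>g\<close>. The exceptional set is finite and \<open>g\<close> is continuous, so the
  fundamental theorem of calculus applies.
\<close>

lemma tropical_jensen:
  assumes g: "\<And>x. has_slopes g x (L x) (R x)" and "r \<ge> 0"
  shows "trop_counting r (trop_recip g) - trop_counting r g = (g r + g (- r)) / 2 - g 0"
proof -
  let ?S = "{s. s \<in> {-r..r} \<and> L s \<noteq> R s}"
  have "((\<lambda>t. R t - L (- t)) has_integral (g r + g (- r)) - (g 0 + g (- 0))) {0..r}"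
  proof (rule fundamental_theorem_of_calculus_interior_strong[of "?S \<union> uminus ` ?S"])
    show "finite (?S \<union> uminus ` ?S)"
      using sum_slope_jumps(1)[OF g, of "- r" r] \<open>r \<ge> 0\<close> by auto
    have "continuous_on UNIV g"
      using has_slopes_continuous[OF g] by (simp add: continuous_on_eq_continuous_at)
    then show "continuous_on {0..r} (\<lambda>t. g t + g (- t))"
      by (auto intro!: continuous_intros continuous_on_compose2[of UNIV g]
          intro: continuous_on_subset)
  next
    fix t assume t: "t \<in> {0<..<r} - (?S \<union> uminus ` ?S)"
    then have "t \<notin> ?S" "- (- t) \<notin> uminus ` ?S" by simp_all
    then have "t \<notin> ?S" "- t \<notin> ?S" using image_eqI[of t uminus "- t" ?S] by auto
    then have eq: "L t = R t" "L (- t) = R (- t)" using t by auto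
    have "(g has_real_derivative R t) (at t)" "(g has_real_derivative L (- t)) (at (- t))"
      using has_slopes_imp_DERIV g eq by metis+
    then have "((\<lambda>t. g t + g (- t)) has_real_derivative R t + L (- t) * - 1) (at t)"
      by (intro DERIV_add DERIV_chain2[of g]) (auto intro!: derivative_eq_intros)
    then show "((\<lambda>t. g t + g (- t)) has_vector_derivative R t - L (- t)) (at t)"
      by (simp add: has_real_derivative_iff_has_vector_derivative)
  qed fact
  then have "integral {0..r} (\<lambda>t. R t - L (- t)) = g r + g (- r) - 2 * g 0"
    by (simp add: integral_unique)
  moreover have "integral {0..r} (\<lambda>t. R t - L (- t)) =
      integral {0..r} (\<lambda>t. trop_pole_count t (trop_recip g) - trop_pole_count t g)"
    by (rule integral_cong) (simp add: trop_pole_count_recip_diff[OF g])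
  moreover have "\<dots> = integral {0..r} (\<lambda>t. trop_pole_count t (trop_recip g)) -
      integral {0..r} (\<lambda>t. trop_pole_count t g)"
    by (intro integral_diff trop_pole_count_integrable[OF g]
        trop_pole_count_integrable[OF has_slopes_trop_recip[OF g]])
  ultimately show ?thesis
    unfolding trop_counting_def by (simp add: field_simps)
qed

section \<open>The second main theorem\<close>

lemma trop_proximity_nonneg: "trop_proximity r g \<ge> 0"
  by (simp add: trop_proximity_def)

lemma counting_recip_le_characteristic:
  assumes g: "\<And>x. has_slopes g x (L x) (R x)" and "r \<ge> 0"
  shows "trop_counting r (trop_recip g) \<le> trop_characteristic r g + \<bar>g 0\<bar>"
  using tropical_jensen[OF g \<open>r \<ge> 0\<close>]
  unfolding trop_characteristic_def trop_proximity_def by (auto simp: field_simps)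

text \<open>
  By Jensen's formula for \<open>f \<oplus> c\<close>, the right-hand side is \<open>N(r, f)\<close> plus the mean of
  \<open>max(f, c)\<close> over \<open>\<plusminus>r\<close> minus \<open>max(f(0), c)\<close>. Replacing \<open>max(f, c)\<close> by \<open>max(f, 0)\<close> costs at most
  \<open>\<bar>c\<bar>\<close> and leaves the proximity function of \<open>f\<close>.
\<close>

lemma characteristic_le_truncated_counting:
  assumes f: "\<And>x. has_slopes f x (L x) (R x)" and "r \<ge> 0"
  shows "trop_characteristic r f - (\<bar>c\<bar> + \<bar>max (f 0) c\<bar>)
    \<le> trop_counting r (trop_recip (trop_add f (ereal c))) + trop_counting r f
      - trop_counting r (trop_add f (ereal c))"
proof -
  have "\<forall>x. \<exists>l r. has_slopes (trop_add f (ereal c)) x l r"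
    by (intro allI has_slopes_trop_add[OF f]) simp
  then obtain L' R' where g: "\<And>x. has_slopes (trop_add f (ereal c)) x (L' x) (R' x)"
    by metis
  have "max y 0 - \<bar>c\<bar> \<le> max y c" for y by linarith
  from this[of "f r"] this[of "f (- r)"] show ?thesis
    using tropical_jensen[OF g \<open>r \<ge> 0\<close>]
    unfolding trop_characteristic_def trop_proximity_def
    by (simp add: field_simps)
qed

text \<open>Near a pole of \<open>f\<close> where the value exceeds \<open>a\<close>, the function \<open>f \<oplus> a\<close> is \<open>f\<close> itself.\<close>

lemma trop_counting_le_trop_add:
  assumes f: "\<And>x. has_slopes f x (L x) (R x)" and a: "a \<noteq> \<infinity>"
    and above: "\<And>\<alpha>. \<alpha> \<in> trop_poles f \<Longrightarrow> a < ereal (f \<alpha>)"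
  shows "trop_counting r f \<le> trop_counting r (trop_add f a)"
proof -
  have "\<forall>x. \<exists>l r. has_slopes (trop_add f a) x l r"
    using has_slopes_trop_add[OF f a] by auto
  then obtain L' R' where g: "\<And>x. has_slopes (trop_add f a) x (L' x) (R' x)"
    by metis
  have same: "trop_omega (trop_add f a) s = trop_omega f s" if "s \<in> trop_poles f" for s
    using trop_omega_eq[OF f[of s]] trop_omega_eq[OF has_slopes_trop_add_above[OF f above[OF that]]]
    by simp
  have "trop_pole_count t f \<le> trop_pole_count t (trop_add f a)" for t
  proof -
    have "trop_pole_count t f = (\<Sum>s | s \<in> trop_poles f \<and> \<bar>s\<bar> \<le> t. \<bar>trop_omega (trop_add f a) s\<bar>)"
      unfolding trop_pole_count_def by (rule sum.cong) (auto simp: same)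
    also have "\<dots> \<le> trop_pole_count t (trop_add f a)"
      unfolding trop_pole_count_def
      by (intro sum_mono2 finite_trop_poles[OF g]) (auto simp: trop_poles_def same)
    finally show ?thesis .
  qed
  then show ?thesis
    unfolding trop_counting_def
    by (intro mult_left_mono integral_le trop_pole_count_integrable[OF f]
        trop_pole_count_integrable[OF g]) auto
qed

theorem theorem5p3:
  fixes f :: "real \<Rightarrow> real" and q :: nat and a :: "nat \<Rightarrow> ereal"
  assumes "tropical_meromorphic f"
    and "\<not> f constant_on UNIV"
    and "q \<ge> 1"
    and "\<And>j. j \<in> {1..q} \<Longrightarrow> a j \<noteq> \<infinity>"
    and "inj_on a {1..q}"
  shows "(\<exists>C. \<forall>r>0.
            (real q - 2) * trop_characteristic r f + trop_counting r f
              + trop_counting r (trop_recip f)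
            \<le> (\<Sum>j=1..q. trop_counting r (trop_recip (trop_add f (a j)))
                 + trop_counting r f - trop_counting r (trop_add f (a j))) + C)
       \<and> (Max (a ` {1..q}) < (INF \<alpha>\<in>trop_poles f. ereal (f \<alpha>)) \<longrightarrow>
          (\<exists>C. \<forall>r>0.
            (real q - 2) * trop_characteristic r f + trop_counting r f
              + trop_counting r (trop_recip f)
            \<le> (\<Sum>j=1..q. trop_counting r (trop_recip (trop_add f (a j)))) + C))"
proof -
  obtain L R where f: "\<And>x. has_slopes f x (L x) (R x)"
    using tropical_meromorphic_has_slopes[OF assms(1)] by blast
  define S where "S r j = trop_counting r (trop_recip (trop_add f (a j)))
      + trop_counting r f - trop_counting r (trop_add f (a j))" for r j
  (* Where a j is -\<infinity> this gives c j = 0. The error K j is still nonnegative there, so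
     all the K j can be summed without singling out that index. *)
  define c where "c j = real_of_ereal (a j)" for j
  define K where "K j = \<bar>c j\<bar> + \<bar>max (f 0) (c j)\<bar>" for j
  have K0: "K j \<ge> 0" for j by (simp add: K_def)
  have S_fin: "trop_characteristic r f - K j \<le> S r j"
    if "j \<in> {1..q}" "a j \<noteq> -\<infinity>" "r > 0" for r j
  proof -
    have "a j = ereal (c j)" using that assms(4)[of j] by (cases "a j") (auto simp: c_def)
    then show ?thesis
      using characteristic_le_truncated_counting[OF f, of r "c j"] that
      by (simp add: S_def K_def)
  qed
  have S_MInf: "S r j = trop_counting r (trop_recip f)" if "a j = -\<infinity>" for r j
    using that by (simp add: S_def)
  have first: "(real q - 2) * trop_characteristic r f + trop_counting r f
      + trop_counting r (trop_recip f) \<le> (\<Sum>j=1..q. S r j) + ((\<Sum>j=1..q. K j) + \<bar>f 0\<bar>)"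
    if r: "r > 0" for r
  proof -
    let ?T = "trop_characteristic r f"
    have N: "trop_counting r f \<le> ?T"
      using trop_proximity_nonneg[of r f] by (simp add: trop_characteristic_def)
    have N': "trop_counting r (trop_recip f) \<le> ?T + \<bar>f 0\<bar>"
      using counting_recip_le_characteristic[OF f, of r] r by simp
    have bound: "real (card J) * ?T - (\<Sum>j\<in>J. K j) \<le> (\<Sum>j\<in>J. S r j)"
      if "J \<subseteq> {1..q}" "\<And>j. j \<in> J \<Longrightarrow> a j \<noteq> -\<infinity>" for J
    proof -
      have "(\<Sum>j\<in>J. ?T - K j) \<le> (\<Sum>j\<in>J. S r j)"
        using that by (intro sum_mono S_fin r) auto
      then show ?thesis by (simp add: sum_subtractf)
    qed
    show ?thesis
    proof (cases "\<exists>j\<in>{1..q}. a j = -\<infinity>")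
      case False
      then have "real q * ?T - (\<Sum>j=1..q. K j) \<le> (\<Sum>j=1..q. S r j)"
        using bound[of "{1..q}"] by simp
      then show ?thesis using N N' by (simp add: algebra_simps)
    next
      case True
      then obtain i where i: "i \<in> {1..q}" "a i = -\<infinity>" by blast
      have "real (q - 1) * ?T - (\<Sum>j\<in>{1..q} - {i}. K j) \<le> (\<Sum>j\<in>{1..q} - {i}. S r j)"
      proof -
        have "a j \<noteq> -\<infinity>" if "j \<in> {1..q} - {i}" for j
          using inj_onD[OF assms(5), of j i] i that by auto
        then show ?thesis using bound[of "{1..q} - {i}"] i(1) by simp
      qed
      moreover have "(\<Sum>j=1..q. S r j) = trop_counting r (trop_recip f) + (\<Sum>j\<in>{1..q} - {i}. S r j)"
        using sum.remove[OF _ i(1), of "S r"] S_MInf[OF i(2), of r] by simp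
      moreover have "(\<Sum>j\<in>{1..q} - {i}. K j) \<le> (\<Sum>j=1..q. K j)"
        by (intro sum_mono2) (auto simp: K0)
      moreover have "real (q - 1) = real q - 1" using assms(3) by simp
      ultimately show ?thesis using N by (simp add: algebra_simps)
    qed
  qed
  moreover have "(\<Sum>j=1..q. S r j) \<le> (\<Sum>j=1..q. trop_counting r (trop_recip (trop_add f (a j))))"
    if less: "Max (a ` {1..q}) < (INF \<alpha>\<in>trop_poles f. ereal (f \<alpha>))" for r
  proof (rule sum_mono)
    fix j assume j: "j \<in> {1..q}"
    have "a j < ereal (f \<alpha>)" if "\<alpha> \<in> trop_poles f" for \<alpha>
    proof -
      have "a j \<le> Max (a ` {1..q})" using j by simp
      also note less
      also have "(INF \<alpha>\<in>trop_poles f. ereal (f \<alpha>)) \<le> ereal (f \<alpha>)"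
        using that by (rule INF_lower)
      finally show ?thesis .
    qed
    then have "trop_counting r f \<le> trop_counting r (trop_add f (a j))"
      by (intro trop_counting_le_trop_add[OF f] assms(4)[OF j])
    then show "S r j \<le> trop_counting r (trop_recip (trop_add f (a j)))"
      by (simp add: S_def)
  qed
  ultimately show ?thesis
    unfolding S_def by (meson add_right_mono order_trans)
qed

end
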